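(* Let $G$ be a compactly presented locally compact group with compact symmetric generating set $S$, let $\delta$ be its Dehn function, and let $\mathcal{F}$ be an efficient set of words in $S$, with efficiency constant $C$. Then for every integer $k\ge1$ and every real $n>0$ we have $$\delta(n)\le k\,\delta\left((C+1)\left\lceil \frac nk\right\rceil\right)+\delta_{\mathcal{F}[k]}\left(Ck\left\lceil \frac nk\right\rceil\right);$$ in particular, for $n\ge k$ we have $$\delta(n)\le k\,\delta\left((C+1)\frac{2n}k\right)+\delta_{\mathcal{F}[k]}(2Cn).$$
   Context: Compact presentability means that there is an integer $\ell$ such that the abstract group $G$ has a presentation with generating set $S$ and relators of length $\le\ell$; fix such $(S,\ell)$. A relation (null-homotopic word) is a word in the letters of $S$ representing the trivial element of $G$; its area is the least $m$ such that it is, in the free group on $S$, a product of $\le m$ conjugates of relations of length $\le\ell$. For real $x\ge 0$, the Dehn function is $\delta(x)=\sup\{\mathrm{area}(w): w\text{ a relation of length}\le x\}$. For words $w,w'$ in $S$, $w\equiv w'$ means they represent the same element of $G$, and $|w|_S$ is the length of the word $w$. $\lceil x\rceil$ is the least integer $\ge x$. For a set $\mathcal{F}$ of words in $S$, $\mathcal{F}[k]$ is the set of words obtained as the concatenation of $\le k$ words of $\mathcal{F}$. For real $x\ge 0$, the restricted Dehn function $\delta_{\mathcal{F}}(x)$ is the supremum of the areas of the null-homotopic words of length $\le x$ belonging to $\mathcal{F}$ (with $\sup\emptyset=0$). The set $\mathcal{F}$ is efficient, with efficiency constant $C$, if for every word $w$ in $S$ there exists $w'\in\mathcal{F}$ with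 $w'\equiv w$ and $|w'|_S\le C|w|_S$. *)

theory Defs
  imports "HOL-Analysis.Analysis" "HOL-Library.Extended_Nat"
begin

text \<open>
  The ambient group is a type of class \<^class>\<open>topological_group_add\<close>. The class
  \<^class>\<open>group_add\<close> does not assume commutativity: the group law is merely written additively,
  so \<open>0\<close> is the identity, \<open>- s\<close> the inverse of \<open>s\<close>.

  A word in \<open>S\<close> is a not necessarily reduced word in the generators of the free group on \<open>S\<close> and
  their formal inverses: \<open>(True, s)\<close> is the letter \<open>s\<close>, and \<open>(False, s)\<close> its formal inverse.
  Formal inverses are needed even though \<open>S\<close> will be symmetric, since in the free group on \<open>S\<close> the
  letter \<open>- s\<close> is a generator unrelated to \<open>s\<close>. In particular the relations of length at most \<open>l\<close>
  are closed under inversion in the free group, as the definition of area requires.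
\<close>

type_synonym 'a gword = "(bool \<times> 'a) list"

definition words :: "'a set \<Rightarrow> 'a gword set" where
  "words S = lists (UNIV \<times> S)"

definition word_val :: "'a::group_add gword \<Rightarrow> 'a" where
  "word_val w = (\<Sum>(b, s)\<leftarrow>w. if b then s else - s)"

definition word_inv :: "'a gword \<Rightarrow> 'a gword" where
  "word_inv w = rev (map (\<lambda>(b, s). (\<not> b, s)) w)"

inductive free_cancel :: "'a gword \<Rightarrow> 'a gword \<Rightarrow> bool" where
  "free_cancel (u @ [(b, s), (\<not> b, s)] @ v) (u @ v)"

text \<open>
  Equality in the free group. No generating set is mentioned, because the free group on \<open>S\<close>
  embeds in the free group on the whole type.
\<close>

definition free_eq :: "'a gword \<Rightarrow> 'a gword \<Rightarrow> bool" where
  "free_eq = equivclp free_cancel"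

definition conj_product :: "('a gword \<times> 'a gword) list \<Rightarrow> 'a gword" where
  "conj_product ps = concat (map (\<lambda>(u, r). u @ r @ word_inv u) ps)"

definition normal_closure :: "'a set \<Rightarrow> 'a gword set \<Rightarrow> 'a gword set" where
  "normal_closure S R =
     {w \<in> words S. \<exists>ps. set ps \<subseteq> words S \<times> (R \<union> word_inv ` R) \<and> free_eq w (conj_product ps)}"

definition relations :: "'a::group_add set \<Rightarrow> 'a gword set" where
  "relations S = {w \<in> words S. word_val w = 0}"

definition generates :: "'a::group_add set \<Rightarrow> bool" where
  "generates S \<longleftrightarrow> word_val ` words S = UNIV"

definition presents :: "'a::group_add set \<Rightarrow> 'a gword set \<Rightarrow> bool" where
  "presents S R \<longleftrightarrow> generates S \<and> R \<subseteq> words S \<and> normal_closure S R = relations S"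

definition compact_presentation ::
  "'a::{topological_group_add, t2_space} set \<Rightarrow> nat \<Rightarrow> bool" where
  "compact_presentation S l \<longleftrightarrow>
     compact S \<and> (\<exists>R. presents S R \<and> (\<forall>r\<in>R. length r \<le> l))"

text \<open>
  Areas and Dehn functions take values in \<^typ>\<open>enat\<close>, where \<open>Sup {} = 0\<close> and \<open>Inf {} = \<infinity>\<close>.
\<close>

definition area :: "'a::group_add set \<Rightarrow> nat \<Rightarrow> 'a gword \<Rightarrow> enat" where
  "area S l w = Inf {enat m | m. \<exists>ps. length ps \<le> m \<and>
     set ps \<subseteq> words S \<times> {r \<in> relations S. length r \<le> l} \<and> free_eq w (conj_product ps)}"

definition dehn :: "'a::group_add set \<Rightarrow> nat \<Rightarrow> real \<Rightarrow> enat" where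
  "dehn S l x = Sup (area S l ` {w \<in> relations S. real (length w) \<le> x})"

definition restricted_dehn ::
  "'a::group_add set \<Rightarrow> nat \<Rightarrow> 'a gword set \<Rightarrow> real \<Rightarrow> enat" where
  "restricted_dehn S l F x =
     Sup (area S l ` {w \<in> relations S. w \<in> F \<and> real (length w) \<le> x})"

definition concats :: "'a gword set \<Rightarrow> nat \<Rightarrow> 'a gword set" where
  "concats F k = {concat ws | ws. length ws \<le> k \<and> set ws \<subseteq> F}"

definition efficient :: "'a::group_add set \<Rightarrow> real \<Rightarrow> 'a gword set \<Rightarrow> bool" where
  "efficient S C F \<longleftrightarrow> F \<subseteq> words S \<and>
     (\<forall>w \<in> words S. \<exists>w' \<in> F. word_val w' = word_val w \<and> real (length w') \<le> C * real (length w))"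

end

theory Submission
  imports Defs
begin

text \<open>
  Cut a relation \<open>w\<close> into \<open>k\<close> words \<open>w\<^sub>i\<close> of length at most \<open>\<lceil>n/k\<rceil>\<close> and replace each by an
  equivalent \<open>w\<^sub>i'\<close> in \<open>F\<close>. Each replacement costs the area of the relation
  \<open>w\<^sub>i w\<^sub>i'\<^sup>-\<^sup>1\<close>, of length at most \<open>(C + 1)\<lceil>n/k\<rceil>\<close>, and what remains is the relation
  \<open>w\<^sub>1' \<dots> w\<^sub>k'\<close> in \<open>F[k]\<close>, of length at most \<open>Ck\<lceil>n/k\<rceil>\<close>.
\<close>

lemma free_eq_refl [simp]: "free_eq w w"
  by (simp add: free_eq_def)

lemma free_eq_sym: "free_eq u v \<Longrightarrow> free_eq v u"
  by (simp add: free_eq_def equivclp_sym)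

lemma free_eq_trans [trans]: "free_eq u v \<Longrightarrow> free_eq v w \<Longrightarrow> free_eq u w"
  unfolding free_eq_def by (rule equivclp_trans)

lemma free_cancel_context:
  assumes "free_cancel u v"
  shows "free_cancel (p @ u @ q) (p @ v @ q)"
  using assms
proof cases
  case (1 x b s y)
  then show ?thesis
    using free_cancel.intros[of "p @ x" b s "y @ q"] by simp
qed

lemma free_eq_context:
  assumes "free_eq u v"
  shows "free_eq (p @ u @ q) (p @ v @ q)"
  using assms unfolding free_eq_def
proof (induction rule: equivclp_induct)
  case base
  show ?case by simp
next
  case (step y z)
  then show ?case
    by (meson equivclp_into_equivclp free_cancel_context)
qed

lemma free_eq_append:
  assumes "free_eq u u'" "free_eq v v'"
  shows "free_eq (u @ v) (u' @ v')"
  using free_eq_context[OF assms(1), of "[]" v] free_eq_context[OF assms(2), of u' "[]"]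
  by (auto intro: free_eq_trans)

lemma word_inv_Nil [simp]: "word_inv [] = []"
  by (simp add: word_inv_def)

lemma word_inv_append [simp]: "word_inv (u @ v) = word_inv v @ word_inv u"
  by (simp add: word_inv_def)

lemma length_word_inv [simp]: "length (word_inv w) = length w"
  by (simp add: word_inv_def)

lemma free_eq_inv_append: "free_eq (word_inv w @ w) []"
proof (induction w)
  case Nil
  show ?case by simp
next
  case (Cons x w)
  obtain b s where x: "x = (b, s)" by fastforce
  have "free_cancel (word_inv w @ [(\<not> b, s), (\<not> \<not> b, s)] @ w) (word_inv w @ w)"
    by (rule free_cancel.intros)
  then have "free_eq (word_inv (x # w) @ (x # w)) (word_inv w @ w)"
    unfolding free_eq_def by (simp add: x word_inv_def r_into_equivclp)
  then show ?case
    using Cons.IH by (rule free_eq_trans)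
qed

lemma Nil_in_words [simp]: "[] \<in> words S"
  by (simp add: words_def)

lemma append_in_words_iff [simp]: "u @ v \<in> words S \<longleftrightarrow> u \<in> words S \<and> v \<in> words S"
  by (auto simp: words_def)

lemma word_inv_in_words [simp]: "w \<in> words S \<Longrightarrow> word_inv w \<in> words S"
  by (auto simp: words_def word_inv_def)

lemma concat_in_words: "set ws \<subseteq> words S \<Longrightarrow> concat ws \<in> words S"
  by (induction ws) auto

lemma word_val_append [simp]: "word_val (u @ v) = word_val u + word_val v"
  by (simp add: word_val_def)

lemma word_val_concat: "word_val (concat ws) = sum_list (map word_val ws)"
  by (induction ws) (simp_all add: word_val_def)

lemma word_val_inv [simp]: "word_val (word_inv w) = - word_val w"
proof (induction w)
  case Nil
  show ?case by (simp add: word_val_def)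
next
  case (Cons x w)
  then show ?case
    by (cases x) (simp add: word_val_def word_inv_def minus_add)
qed

lemma conj_product_append: "conj_product (ps @ qs) = conj_product ps @ conj_product qs"
  by (simp add: conj_product_def)

lemma free_eq_conj_product_conjugate:
  "free_eq (conj_product (map (\<lambda>(u, r). (p @ u, r)) ps)) (p @ conj_product ps @ word_inv p)"
proof (induction ps)
  case Nil
  show ?case
    using free_eq_inv_append[of "word_inv p"] free_eq_sym
    by (simp add: conj_product_def word_inv_def rev_map comp_def case_prod_unfold)
next
  case (Cons ur ps)
  obtain u r where ur: "ur = (u, r)" by fastforce
  let ?c = "u @ r @ word_inv u"
  have "free_eq (conj_product (map (\<lambda>(u, r). (p @ u, r)) (ur # ps)))
      ((p @ ?c @ word_inv p) @ p @ conj_product ps @ word_inv p)"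
    using free_eq_append[OF free_eq_refl Cons.IH, of "p @ ?c @ word_inv p"]
    by (simp add: ur conj_product_def)
  also have "free_eq \<dots> (p @ conj_product (ur # ps) @ word_inv p)"
    using free_eq_context[OF free_eq_inv_append[of p], of "p @ ?c" "conj_product ps @ word_inv p"]
    by (simp add: ur conj_product_def)
  finally show ?case .
qed

lemma area_le_iff:
  "area S l w \<le> enat m \<longleftrightarrow> (\<exists>ps. length ps \<le> m \<and>
     set ps \<subseteq> words S \<times> {r \<in> relations S. length r \<le> l} \<and> free_eq w (conj_product ps))"
  (is "_ \<longleftrightarrow> (\<exists>ps. length ps \<le> m \<and> ?P ps)")
proof
  define A where "A = {enat m | m. \<exists>ps. length ps \<le> m \<and> ?P ps}"
  have area: "area S l w = Inf A"
    by (simp add: area_def A_def)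
  {
    assume le: "area S l w \<le> enat m"
    then have "A \<noteq> {}"
      by (auto simp: area Inf_enat_def)
    then have "Inf A \<in> A"
      unfolding Inf_enat_def by (auto intro: LeastI)
    then obtain m' ps where "Inf A = enat m'" "length ps \<le> m'" "?P ps"
      unfolding A_def by blast
    then show "\<exists>ps. length ps \<le> m \<and> ?P ps"
      using le by (auto simp: area intro: order_trans)
  }
  assume "\<exists>ps. length ps \<le> m \<and> ?P ps"
  then have "enat m \<in> A"
    unfolding A_def by blast
  then show "area S l w \<le> enat m"
    unfolding area by (rule Inf_lower)
qed

lemma area_Nil [simp]: "area S l [] = 0"
proof -
  have "area S l [] \<le> enat 0"
    unfolding area_le_iff by (rule exI[of _ "[]"]) (simp add: conj_product_def)
  then show ?thesis by (simp flip: zero_enat_def)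
qed

text \<open>In the free group, \<open>p w q = p (w w'\<^sup>-\<^sup>1) p\<^sup>-\<^sup>1 \<cdot> p w' q\<close>.\<close>

lemma area_replace:
  assumes p: "p \<in> words S"
  shows "area S l (p @ w @ q) \<le> area S l (w @ word_inv w') + area S l (p @ w' @ q)"
proof (cases "area S l (w @ word_inv w') = \<infinity> \<or> area S l (p @ w' @ q) = \<infinity>")
  case True
  then show ?thesis by auto
next
  case False
  then obtain a b where a: "area S l (w @ word_inv w') = enat a"
    and b: "area S l (p @ w' @ q) = enat b"
    by auto
  let ?R = "{r \<in> relations S. length r \<le> l}"
  obtain ps where ps: "length ps \<le> a" "set ps \<subseteq> words S \<times> ?R"
      "free_eq (w @ word_inv w') (conj_product ps)"
    using a area_le_iff[of S l "w @ word_inv w'" a] by auto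
  obtain qs where qs: "length qs \<le> b" "set qs \<subseteq> words S \<times> ?R"
      "free_eq (p @ w' @ q) (conj_product qs)"
    using b area_le_iff[of S l "p @ w' @ q" b] by auto
  define ps' where "ps' = map (\<lambda>(u, r). (p @ u, r)) ps"
  have "free_eq (p @ w @ q) (p @ w @ word_inv w' @ w' @ q)"
    using free_eq_sym[OF free_eq_context[OF free_eq_inv_append[of w'], of "p @ w" q]] by simp
  also have "free_eq \<dots> (p @ w @ word_inv w' @ word_inv p @ p @ w' @ q)"
    using free_eq_sym[OF free_eq_context[OF free_eq_inv_append[of p], of "p @ w @ word_inv w'" "w' @ q"]]
    by simp
  also have "free_eq \<dots> (p @ conj_product ps @ word_inv p @ p @ w' @ q)"
    using free_eq_context[OF ps(3), of p "word_inv p @ p @ w' @ q"] by simp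
  also have "free_eq \<dots> (conj_product ps' @ conj_product qs)"
    using free_eq_append[OF free_eq_sym[OF free_eq_conj_product_conjugate[of p ps]] qs(3)]
    by (simp add: ps'_def)
  finally have "free_eq (p @ w @ q) (conj_product (ps' @ qs))"
    by (simp add: conj_product_append)
  moreover have "set (ps' @ qs) \<subseteq> words S \<times> ?R"
    using ps(2) qs(2) p by (auto simp: ps'_def)
  moreover have "length (ps' @ qs) \<le> a + b"
    using ps(1) qs(1) by (simp add: ps'_def)
  ultimately have "area S l (p @ w @ q) \<le> enat (a + b)"
    unfolding area_le_iff by blast
  then show ?thesis by (simp add: a b)
qed

lemma area_replace_concat:
  assumes "list_all2 (\<lambda>w w'. w' \<in> words S \<and> area S l (w @ word_inv w') \<le> D) ws ws'"
    and "p \<in> words S"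
  shows "area S l (p @ concat ws) \<le> of_nat (length ws) * D + area S l (p @ concat ws')"
  using assms
proof (induction ws ws' arbitrary: p rule: list_all2_induct)
  case Nil
  then show ?case by simp
next
  case (Cons w ws w' ws')
  have "area S l (p @ w @ concat ws) \<le> area S l (w @ word_inv w') + area S l (p @ w' @ concat ws)"
    using Cons.prems by (rule area_replace)
  also have "\<dots> \<le> D + (of_nat (length ws) * D + area S l ((p @ w') @ concat ws'))"
    using Cons.hyps Cons.prems Cons.IH[of "p @ w'"] by (intro add_mono) auto
  finally show ?case
    by (simp add: distrib_right add.assoc)
qed

lemma split_into_chunks:
  assumes "length w \<le> k * N"
  obtains ws where "concat ws = w" "length ws = k" "\<And>v. v \<in> set ws \<Longrightarrow> length v \<le> N"
  using assms
proof (induction k arbitrary: w thesis)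
  case 0
  then show ?case by simp
next
  case (Suc k)
  have "length (drop N w) \<le> k * N"
    using Suc.prems(2) by simp
  then obtain ws where "concat ws = drop N w" "length ws = k" "\<And>v. v \<in> set ws \<Longrightarrow> length v \<le> N"
    using Suc.IH by blast
  then show ?case
    by (intro Suc.prems(1)[of "take N w # ws"]) auto
qed

lemma area_le_dehn:
  "w \<in> relations S \<Longrightarrow> real (length w) \<le> x \<Longrightarrow> area S l w \<le> dehn S l x"
  unfolding dehn_def by (blast intro: Sup_upper)

lemma area_le_restricted_dehn:
  "w \<in> relations S \<Longrightarrow> w \<in> F \<Longrightarrow> real (length w) \<le> x \<Longrightarrow> area S l w \<le> restricted_dehn S l F x"
  unfolding restricted_dehn_def by (blast intro: Sup_upper)

lemma dehn_mono: "x \<le> y \<Longrightarrow> dehn S l x \<le> dehn S l y"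
  unfolding dehn_def by (intro Sup_subset_mono image_mono) auto

lemma restricted_dehn_mono: "x \<le> y \<Longrightarrow> restricted_dehn S l F x \<le> restricted_dehn S l F y"
  unfolding restricted_dehn_def by (intro Sup_subset_mono image_mono) auto

lemma efficient_empty_or_nonneg:
  assumes "efficient S C F"
  shows "S = {} \<or> 0 \<le> C"
proof (rule disjCI)
  assume "\<not> 0 \<le> C"
  show "S = {}"
  proof (rule ccontr)
    assume "S \<noteq> {}"
    then obtain s where "[(True, s)] \<in> words S"
      by (auto simp: words_def)
    with assms obtain w' :: "'a gword" where "real (length w') \<le> C * real (length [(True, s)])"
      unfolding efficient_def by blast
    with \<open>\<not> 0 \<le> C\<close> show False by simp
  qed
qed

lemma dehn_empty [simp]: "dehn {} l x = 0"
proof -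
  have "relations ({} :: 'a::group_add set) \<subseteq> {[]}"
    by (auto simp: relations_def words_def)
  then have "area {} l ` {w \<in> relations ({} :: 'a set). real (length w) \<le> x} \<subseteq> {0}"
    by auto
  then have "dehn ({} :: 'a set) l x \<le> Sup {0}"
    unfolding dehn_def by (rule Sup_subset_mono)
  then show ?thesis by simp
qed

lemma dehn_le_chunks:
  assumes eff: "efficient S C F" and "0 \<le> C" and n: "n \<le> real (k * N)"
  shows "dehn S l n \<le> of_nat k * dehn S l ((C + 1) * real N)
           + restricted_dehn S l (concats F k) (C * real k * real N)"
  unfolding dehn_def[of S l n]
proof (rule Sup_least, clarify)
  fix w assume w: "w \<in> relations S" "real (length w) \<le> n"
  then have "length w \<le> k * N"
    using n by linarith
  then obtain ws where ws: "concat ws = w" "length ws = k" "\<And>v. v \<in> set ws \<Longrightarrow> length v \<le> N"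
    by (rule split_into_chunks) blast
  have words: "v \<in> words S" if "v \<in> set ws" for v
    using that w(1) unfolding relations_def words_def ws(1)[symmetric] by fastforce
  obtain f where f: "\<And>v. v \<in> words S \<Longrightarrow> f v \<in> F \<and> word_val (f v) = word_val v
      \<and> real (length (f v)) \<le> C * real (length v)"
    using eff unfolding efficient_def by metis
  have f_words: "f v \<in> words S" if "v \<in> set ws" for v
    using f words[OF that] eff by (auto simp: efficient_def)
  have f_length: "real (length (f v)) \<le> C * real N" if "v \<in> set ws" for v
  proof -
    have "C * real (length v) \<le> C * real N"
      using ws(3)[OF that] \<open>0 \<le> C\<close> by (intro mult_left_mono) auto
    then show ?thesis
      using f[OF words[OF that]] by linarith
  qed
  let ?D = "dehn S l ((C + 1) * real N)"
  have "area S l (v @ word_inv (f v)) \<le> ?D" if "v \<in> set ws" for v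
  proof (rule area_le_dehn)
    show "v @ word_inv (f v) \<in> relations S"
      using f words[OF that] f_words[OF that] by (simp add: relations_def)
    show "real (length (v @ word_inv (f v))) \<le> (C + 1) * real N"
      using f_length[OF that] ws(3)[OF that] by (simp add: distrib_right)
  qed
  then have "list_all2 (\<lambda>v v'. v' \<in> words S \<and> area S l (v @ word_inv v') \<le> ?D) ws (map f ws)"
    using f_words by (simp add: list_all2_map2 list.rel_refl_strong)
  from area_replace_concat[OF this, of "[]"]
  have "area S l w \<le> of_nat k * ?D + area S l (concat (map f ws))"
    by (simp add: ws)
  also have "area S l (concat (map f ws)) \<le> restricted_dehn S l (concats F k) (C * real k * real N)"
  proof (rule area_le_restricted_dehn)
    have "map word_val (map f ws) = map word_val ws"
      using f words by simp
    then have "word_val (concat (map f ws)) = word_val w"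
      by (simp only: word_val_concat flip: ws(1))
    moreover have "concat (map f ws) \<in> words S"
      using f_words by (intro concat_in_words) auto
    ultimately show "concat (map f ws) \<in> relations S"
      using w(1) by (simp add: relations_def)
    show "concat (map f ws) \<in> concats F k"
      unfolding concats_def using f words ws(2)
      by (intro CollectI exI[of _ "map f ws"]) auto
    have "real (length (concat (map f ws))) = (\<Sum>v\<leftarrow>ws. real (length (f v)))"
      by (induction ws) auto
    also have "\<dots> \<le> (\<Sum>v\<leftarrow>ws. C * real N)"
      using f_length by (rule sum_list_mono)
    finally show "real (length (concat (map f ws))) \<le> C * real k * real N"
      by (simp add: sum_list_triv ws(2) mult_ac)
  qed
  finally show "area S l w \<le> of_nat k * ?D
      + restricted_dehn S l (concats F k) (C * real k * real N)"
    by (simp add: add_left_mono)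
qed

theorem lemma4p2:
  fixes S :: "'a::{topological_group_add, t2_space} set"
    and l :: nat and C :: real and F :: "'a gword set"
    and k :: nat and n :: real
  assumes "locally_compact_space (euclidean :: 'a topology)"
    and "compact_presentation S l"
    and "\<forall>s\<in>S. - s \<in> S"
    and "efficient S C F"
    and "k \<ge> 1" and "n > 0"
  shows "dehn S l n \<le> of_nat k * dehn S l ((C + 1) * of_int \<lceil>n / real k\<rceil>)
           + restricted_dehn S l (concats F k) (C * real k * of_int \<lceil>n / real k\<rceil>)
    \<and> (n \<ge> real k \<longrightarrow>
         dehn S l n \<le> of_nat k * dehn S l ((C + 1) * (2 * n / real k))
           + restricted_dehn S l (concats F k) (2 * C * n))"
proof (cases "S = {}")
  case True
  then show ?thesis by simp
next
  case False
  then have "0 \<le> C"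
    using efficient_empty_or_nonneg[OF assms(4)] by blast
  define N where "N = nat \<lceil>n / real k\<rceil>"
  have N: "real N = of_int \<lceil>n / real k\<rceil>"
    using assms(5,6) by (simp add: N_def)
  have "n / real k \<le> real N"
    unfolding N by (rule le_of_int_ceiling)
  then have "n \<le> real (k * N)"
    using assms(5) by (simp add: divide_le_eq mult.commute)
  note bound = dehn_le_chunks[OF assms(4) \<open>0 \<le> C\<close> this, of l]
  have "dehn S l n \<le> of_nat k * dehn S l ((C + 1) * (2 * n / real k))
      + restricted_dehn S l (concats F k) (2 * C * n)" if "n \<ge> real k"
  proof -
    have "1 \<le> n / real k"
      using that assms(5) by simp
    then have le: "real N \<le> 2 * n / real k"
      unfolding N by linarith
    then have "(C + 1) * real N \<le> (C + 1) * (2 * n / real k)"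
      using \<open>0 \<le> C\<close> by (intro mult_left_mono) auto
    moreover have "C * real k * real N \<le> 2 * C * n"
      using mult_left_mono[OF le, of "C * real k"] \<open>0 \<le> C\<close> assms(5) by (simp add: mult_ac)
    ultimately show ?thesis
      by (intro order_trans[OF bound] add_mono[OF mult_left_mono[OF dehn_mono] restricted_dehn_mono]) auto
  qed
  with bound show ?thesis
    by (simp add: N)
qed

end
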